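(* Consider the non-autonomous Hamiltonian system (with the true anomaly $\nu$ as time and $'=d/d\nu$) $$x'=y-\Sigma x,\qquad y'=-\Sigma y+\nabla_x V(x,\nu,\mu,\epsilon),\qquad (x,y)\in\Gamma\times\mathbb{R}^3 .$$ This system admits a family of equilibrium points of the form $$z^*=(x^*,y^* )=(a,\,b,\,0,\,-b,\,a,\,0),$$ where $(a,b)$ belongs to the circumference of radius $1$ centered at $(-1,0)$ in the $x_1x_2$-plane, i.e. $(1+a)^2+b^2=1$. (Equilibrium means that $(x',y')=(0,0)$ at $z^*$ for all $\nu\in\mathbb{R}$, $\mu\in I$ and $\epsilon\in[0,1)$.)
   Context: Here $x=(x_1,x_2,x_3)$, $y=(y_1,y_2,y_3)$, $\Gamma=\{(x_1,x_2,x_3)\in\mathbb{R}^3:\ x_1\neq-1\ \text{or}\ x_2\neq 0\}$, $I$ is a subset of the positive real numbers ($\mu\in I$ is a mass-ratio parameter), $\epsilon\in[0,1)$ is the eccentricity, $\nu\in\mathbb{R}$, and $$\Sigma=\begin{bmatrix}0&-1&0\\1&0&0\\0&0&0\end{bmatrix}.$$ The potential is $$V(x,\nu,\mu,\epsilon)=\frac{1}{1+\epsilon\cos\nu}\left(-\frac12\,\epsilon\cos\nu\,\Vert x\Vert^2+\frac1\kappa W(x,\mu)+x_1\right),\qquad \kappa=\frac{\mu+4}{4},$$ $$W(x,\mu)=\frac{\mu}{4d_1}+\frac1{d_2},\qquad d_1=\sqrt{(1+x_1)^2+x_2^2},\qquad d_2=\sqrt{(1+x_1)^2+x_2^2+(2\mu+1)x_3^2}.$$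 The Hamiltonian of the system is $H(x,y,\nu,\mu,\epsilon)=\frac12\Vert y\Vert^2-V(x,\nu,\mu,\epsilon)-\langle\Sigma x,y\rangle$. *)

theory Defs
  imports "HOL-Analysis.Analysis"
begin

definition Gamma_set :: "(real^3) set" where
  "Gamma_set = {x. x $ 1 \<noteq> -1 \<or> x $ 2 \<noteq> 0}"

definition Sigma_mat :: "real^3^3" where
  "Sigma_mat = vector [vector [0, -1, 0], vector [1, 0, 0], vector [0, 0, 0]]"

definition kappa :: "real \<Rightarrow> real" where
  "kappa \<mu> = (\<mu> + 4) / 4"

definition d1 :: "real^3 \<Rightarrow> real" where
  "d1 x = sqrt ((1 + x $ 1)\<^sup>2 + (x $ 2)\<^sup>2)"

definition d2 :: "real^3 \<Rightarrow> real \<Rightarrow> real" where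
  "d2 x \<mu> = sqrt ((1 + x $ 1)\<^sup>2 + (x $ 2)\<^sup>2 + (2 * \<mu> + 1) * (x $ 3)\<^sup>2)"

definition W :: "real^3 \<Rightarrow> real \<Rightarrow> real" where
  "W x \<mu> = \<mu> / (4 * d1 x) + 1 / d2 x \<mu>"

definition V :: "real^3 \<Rightarrow> real \<Rightarrow> real \<Rightarrow> real \<Rightarrow> real" where
  "V x \<nu> \<mu> \<epsilon> =
     1 / (1 + \<epsilon> * cos \<nu>) *
       (- (1/2) * \<epsilon> * cos \<nu> * (norm x)\<^sup>2 + 1 / kappa \<mu> * W x \<mu> + x $ 1)"

definition H :: "real^3 \<Rightarrow> real^3 \<Rightarrow> real \<Rightarrow> real \<Rightarrow> real \<Rightarrow> real" where
  "H x y \<nu> \<mu> \<epsilon> = 1/2 * (norm y)\<^sup>2 - V x \<nu> \<mu> \<epsilon> - (Sigma_mat *v x) \<bullet> y"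

text \<open>Meaningful only where \<open>f\<close> is differentiable; for the potential this is guaranteed on
  \<open>Gamma_set\<close> by \<open>V_has_gradient\<close> below.\<close>

definition grad :: "('a::real_inner \<Rightarrow> real) \<Rightarrow> 'a \<Rightarrow> 'a" where
  "grad f x = (THE D. GDERIV f x :> D)"

text \<open>The right-hand side of the system, on the phase space \<open>Gamma_set \<times> UNIV\<close>.\<close>

definition vector_field ::
  "(real^3) \<times> (real^3) \<Rightarrow> real \<Rightarrow> real \<Rightarrow> real \<Rightarrow> (real^3) \<times> (real^3)" where
  "vector_field z \<nu> \<mu> \<epsilon> = (case z of (x, y) \<Rightarrow>
     (y - Sigma_mat *v x, - (Sigma_mat *v y) + grad (\<lambda>x. V x \<nu> \<mu> \<epsilon>) x))"

text \<open>An equilibrium is one point that is stationary for every time and all admissible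
  parameters simultaneously.\<close>

definition equilibrium :: "real set \<Rightarrow> (real^3) \<times> (real^3) \<Rightarrow> bool" where
  "equilibrium I z \<longleftrightarrow> z \<in> Gamma_set \<times> UNIV \<and>
     (\<forall>\<nu>. \<forall>\<mu>\<in>I. \<forall>\<epsilon>\<in>{0..<1}. vector_field z \<nu> \<mu> \<epsilon> = (0, 0))"

lemma grad_eqI:
  assumes "GDERIV f x :> D"
  shows "grad f x = D"
proof -
  have "E = D" if "GDERIV f x :> E" for E
  proof -
    have "(\<lambda>h. h \<bullet> E) = (\<lambda>h. h \<bullet> D)"
      using assms that has_derivative_unique unfolding gderiv_def by blast
    then show ?thesis
      by (metis inner_commute vector_eq_ldot)
  qed
  then show ?thesis
    unfolding grad_def using assms by blast
qed

lemma has_gradient_of_differentiable: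
  fixes f :: "'a::euclidean_space \<Rightarrow> real"
  assumes "f differentiable at x"
  shows "GDERIV f x :> grad f x"
proof -
  obtain f' where f': "(f has_derivative f') (at x)"
    using assms unfolding differentiable_def by blast
  then interpret linear f'
    by (rule has_derivative_linear)
  have "f' = (\<lambda>h. h \<bullet> adjoint f' 1)"
    using adjoint_works[OF linear_axioms, of _ 1] by (simp add: fun_eq_iff)
  then have "GDERIV f x :> adjoint f' 1"
    using f' unfolding gderiv_def by simp
  then show ?thesis
    using grad_eqI by metis
qed

lemma V_has_gradient:
  assumes "x \<in> Gamma_set" and "0 < \<mu>"
  shows "GDERIV (\<lambda>x. V x \<nu> \<mu> \<epsilon>) x :> grad (\<lambda>x. V x \<nu> \<mu> \<epsilon>) x"
proof (rule has_gradient_of_differentiable)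
  define r s where "r = (\<lambda>x::real^3. (1 + x $ 1)\<^sup>2 + (x $ 2)\<^sup>2)"
    and "s = (\<lambda>x::real^3. (1 + x $ 1)\<^sup>2 + (x $ 2)\<^sup>2 + (2 * \<mu> + 1) * (x $ 3)\<^sup>2)"
  have r: "0 < r x"
    using assms(1) by (auto simp: r_def Gamma_set_def sum_power2_gt_zero_iff)
  have s: "0 < s x"
  proof -
    have "r x \<le> s x" using assms(2) by (simp add: r_def s_def)
    then show ?thesis using r by linarith
  qed
  have c: "(\<lambda>x::real^3. x $ i) differentiable at x" for i
    by (rule bounded_linear_imp_differentiable) (rule bounded_linear_vec_nth)
  have dr: "r differentiable at x" and ds: "s differentiable at x"
    unfolding r_def s_def by (intro derivative_intros c)+
  have q: "(\<lambda>x. sqrt (f x)) differentiable at x" if "f differentiable at x" "0 < f x"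
    for f :: "real^3 \<Rightarrow> real"
    using that has_derivative_real_sqrt unfolding differentiable_def by blast
  have "(\<lambda>x. \<mu> / (4 * sqrt (r x)) + 1 / sqrt (s x)) differentiable at x"
    using r s by (intro derivative_intros q dr ds) auto
  then have W: "(\<lambda>x. W x \<mu>) differentiable at x"
    by (simp add: W_def d1_def d2_def r_def s_def)
  have n: "(\<lambda>x::real^3. x \<bullet> x) differentiable at x"
    using has_derivative_inner[OF has_derivative_ident has_derivative_ident] differentiableI by blast
  show "(\<lambda>x. V x \<nu> \<mu> \<epsilon>) differentiable at x"
    unfolding V_def power2_norm_eq_inner
    by (intro derivative_intros W n c)
qed

lemma Sigma_mat_skew: "(Sigma_mat *v x) \<bullet> y = - (x \<bullet> (Sigma_mat *v y))"
  by (simp add: Sigma_mat_def matrix_vector_mult_def inner_vec_def sum_3 algebra_simps)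

text \<open>The system is the Hamiltonian system of \<open>H\<close>: the derivatives are
  \<open>x' = \<nabla>\<^sub>y H\<close> and \<open>y' = - \<nabla>\<^sub>x H\<close>.\<close>

lemma vector_field_Hamiltonian:
  assumes "x \<in> Gamma_set" and "0 < \<mu>"
  shows "GDERIV (\<lambda>y. H x y \<nu> \<mu> \<epsilon>) y :> fst (vector_field (x, y) \<nu> \<mu> \<epsilon>)"
    and "GDERIV (\<lambda>x. H x y \<nu> \<mu> \<epsilon>) x :> - snd (vector_field (x, y) \<nu> \<mu> \<epsilon>)"
proof -
  show "GDERIV (\<lambda>y. H x y \<nu> \<mu> \<epsilon>) y :> fst (vector_field (x, y) \<nu> \<mu> \<epsilon>)"
    unfolding gderiv_def H_def vector_field_def power2_norm_eq_inner
    by (auto intro!: derivative_eq_intros simp: fun_eq_iff inner_diff_right inner_commute)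
next
  have "((\<lambda>x. V x \<nu> \<mu> \<epsilon>) has_derivative (\<lambda>h. h \<bullet> grad (\<lambda>x. V x \<nu> \<mu> \<epsilon>) x)) (at x)"
    using V_has_gradient[OF assms] unfolding gderiv_def .
  then show "GDERIV (\<lambda>x. H x y \<nu> \<mu> \<epsilon>) x :> - snd (vector_field (x, y) \<nu> \<mu> \<epsilon>)"
    unfolding gderiv_def H_def vector_field_def Sigma_mat_skew
    by (auto intro!: derivative_eq_intros simp: fun_eq_iff inner_diff_right inner_add_right)
qed

end

theory Submission
  imports Defs
begin

text \<open>
  In the plane \<open>x\<^sub>3 = 0\<close> the two distances \<open>d1\<close> and \<open>d2\<close> agree and both measure the distance to
  the point \<open>(-1, 0, 0)\<close>, so there \<open>W\<close> acts like a single attracting centre of total mass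
  \<open>\<mu> / 4 + 1 = \<kappa>\<close>.  On the unit circle around that point the attraction is \<open>-\<kappa> (1 + x\<^sub>1, x\<^sub>2, 0)\<close>:
  the factor \<open>1 / \<kappa>\<close> turns it into \<open>- x - (1, 0, 0)\<close>, whose constant part
  the linear term \<open>x\<^sub>1\<close> of the potential cancels.  What remains inside the bracket of \<open>V\<close> has gradient
  \<open>- \<epsilon> cos \<nu> x - x = - (1 + \<epsilon> cos \<nu>) x\<close>, and the prefactor removes the dependence on \<open>\<nu>\<close> and
  \<open>\<epsilon>\<close>.  Hence \<open>\<nabla> V = - x\<close> at every point of the circle (\<open>GDERIV_V_unit_circle\<close>), which is
  exactly balanced by the term \<open>- \<Sigma> y = - \<Sigma>\<^sup>2 x = x\<close> of the second equation for the state \<open>y = \<Sigma> x\<close>.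
\<close>

lemma has_derivative_inverse_sqrt_at_1:
  fixes f :: "'a::real_normed_vector \<Rightarrow> real"
  assumes "(f has_derivative f') (at x)" and "f x = 1"
  shows "((\<lambda>x. 1 / sqrt (f x)) has_derivative (\<lambda>h. - f' h / 2)) (at x)"
  using assms by (auto intro!: derivative_eq_intros simp: fun_eq_iff)

lemma has_derivative_vec_nth:
  "((\<lambda>x::real^'n. x $ i) has_derivative (\<lambda>h. h $ i)) (at x)"
  by (rule bounded_linear_imp_has_derivative) (rule bounded_linear_vec_nth)

text \<open>The coefficient \<open>2 * \<mu> + 1\<close> in \<open>d2\<close> multiplies \<open>x\<^sub>3\<^sup>2\<close>, which vanishes to second order on the
  plane \<open>x\<^sub>3 = 0\<close>; this is why both terms of \<open>W\<close> pull in the same direction and only their total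
  weight \<open>\<kappa>\<close> shows.\<close>

lemma has_derivative_W_unit_circle:
  fixes x :: "real^3"
  assumes "(1 + x $ 1)\<^sup>2 + (x $ 2)\<^sup>2 = 1" and "x $ 3 = 0"
  shows "((\<lambda>x. W x \<mu>) has_derivative (\<lambda>h. - kappa \<mu> * ((1 + x $ 1) * h $ 1 + x $ 2 * h $ 2)))
    (at x)"
proof -
  define D where "D = (\<lambda>h::real^3. 2 * ((1 + x $ 1) * h $ 1 + x $ 2 * h $ 2))"
  have "((\<lambda>x::real^3. (1 + x $ 1)\<^sup>2 + (x $ 2)\<^sup>2) has_derivative D) (at x)"
    unfolding D_def
    by (auto intro!: derivative_eq_intros has_derivative_vec_nth simp: fun_eq_iff algebra_simps)
  then have 1: "((\<lambda>x. 1 / d1 x) has_derivative (\<lambda>h. - D h / 2)) (at x)"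
    unfolding d1_def using assms by (intro has_derivative_inverse_sqrt_at_1)
  have "((\<lambda>x::real^3. (1 + x $ 1)\<^sup>2 + (x $ 2)\<^sup>2 + (2 * \<mu> + 1) * (x $ 3)\<^sup>2) has_derivative D) (at x)"
    unfolding D_def using assms(2)
    by (auto intro!: derivative_eq_intros has_derivative_vec_nth simp: fun_eq_iff algebra_simps)
  then have 2: "((\<lambda>x. 1 / d2 x \<mu>) has_derivative (\<lambda>h. - D h / 2)) (at x)"
    unfolding d2_def using assms by (intro has_derivative_inverse_sqrt_at_1) auto
  have "((\<lambda>x. \<mu> / 4 * (1 / d1 x) + 1 / d2 x \<mu>) has_derivative
      (\<lambda>h. \<mu> / 4 * (- D h / 2) + - D h / 2)) (at x)"
    by (intro has_derivative_add has_derivative_mult_right 1 2)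
  moreover have "(\<lambda>x. \<mu> / 4 * (1 / d1 x) + 1 / d2 x \<mu>) = (\<lambda>x. W x \<mu>)"
    by (simp add: W_def)
  moreover have "(\<lambda>h. \<mu> / 4 * (- D h / 2) + - D h / 2) =
      (\<lambda>h. - kappa \<mu> * ((1 + x $ 1) * h $ 1 + x $ 2 * h $ 2))"
    by (simp add: fun_eq_iff D_def kappa_def field_simps)
  ultimately show ?thesis by simp
qed

lemma GDERIV_V_unit_circle:
  fixes x :: "real^3"
  assumes "(1 + x $ 1)\<^sup>2 + (x $ 2)\<^sup>2 = 1" and "x $ 3 = 0"
    and "kappa \<mu> \<noteq> 0" and "1 + \<epsilon> * cos \<nu> \<noteq> 0"
  shows "GDERIV (\<lambda>x. V x \<nu> \<mu> \<epsilon>) x :> - x"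
proof -
  let ?c = "\<epsilon> * cos \<nu>"
  have n: "((\<lambda>x::real^3. (norm x)\<^sup>2) has_derivative (\<lambda>h. 2 * (h \<bullet> x))) (at x)"
    unfolding power2_norm_eq_inner
    by (auto intro!: derivative_eq_intros simp: fun_eq_iff inner_commute)
  have "((\<lambda>x. V x \<nu> \<mu> \<epsilon>) has_derivative
      (\<lambda>h. 1 / (1 + ?c) * (- (1/2) * \<epsilon> * cos \<nu> * (2 * (h \<bullet> x)) +
        1 / kappa \<mu> * (- kappa \<mu> * ((1 + x $ 1) * h $ 1 + x $ 2 * h $ 2)) + h $ 1))) (at x)"
    unfolding V_def
    by (intro has_derivative_add has_derivative_mult_right n has_derivative_vec_nth
        has_derivative_W_unit_circle assms)
  moreover have "1 / (1 + ?c) * (- (1/2) * \<epsilon> * cos \<nu> * (2 * (h \<bullet> x)) +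
        1 / kappa \<mu> * (- kappa \<mu> * ((1 + x $ 1) * h $ 1 + x $ 2 * h $ 2)) + h $ 1)
      = h \<bullet> (- x)" for h
  proof -
    have "h \<bullet> x = x $ 1 * h $ 1 + x $ 2 * h $ 2"
      using assms(2) by (simp add: inner_vec_def sum_3)
    then have "- (1/2) * \<epsilon> * cos \<nu> * (2 * (h \<bullet> x)) +
        1 / kappa \<mu> * (- kappa \<mu> * ((1 + x $ 1) * h $ 1 + x $ 2 * h $ 2)) + h $ 1
      = (1 + ?c) * (h \<bullet> (- x))"
      using assms(3) by (simp add: algebra_simps)
    then show ?thesis using assms(4) by simp
  qed
  ultimately show ?thesis
    unfolding gderiv_def by simp
qed

lemma one_plus_eccentricity_cos_pos:
  fixes \<epsilon> \<nu> :: real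
  assumes "0 \<le> \<epsilon>" and "\<epsilon> < 1"
  shows "0 < 1 + \<epsilon> * cos \<nu>"
proof -
  have "\<epsilon> * (- 1) \<le> \<epsilon> * cos \<nu>"
    using assms(1) by (intro mult_left_mono) auto
  then show ?thesis using assms(2) by linarith
qed

theorem proposition4p1:
  fixes I :: "real set" and a b :: real
  assumes "I \<subseteq> {0<..}"
    and "(1 + a)\<^sup>2 + b\<^sup>2 = 1"
  shows "equilibrium I (vector [a, b, 0], vector [-b, a, 0])"
proof -
  let ?x = "vector [a, b, 0] :: real^3" and ?y = "vector [-b, a, 0] :: real^3"
  have "?x \<in> Gamma_set"
    using assms(2) by (auto simp: Gamma_set_def)
  moreover have "vector_field (?x, ?y) \<nu> \<mu> \<epsilon> = (0, 0)" if "\<mu> \<in> I" "\<epsilon> \<in> {0..<1}" for \<nu> \<mu> \<epsilon>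
  proof -
    have "kappa \<mu> \<noteq> 0"
      using assms(1) that(1) by (auto simp: kappa_def)
    moreover have "1 + \<epsilon> * cos \<nu> \<noteq> 0"
      using one_plus_eccentricity_cos_pos[of \<epsilon> \<nu>] that(2) by auto
    ultimately have "grad (\<lambda>x. V x \<nu> \<mu> \<epsilon>) ?x = - ?x"
      using assms(2) by (intro grad_eqI GDERIV_V_unit_circle) auto
    moreover have "Sigma_mat *v ?x = ?y" and "Sigma_mat *v ?y = - ?x"
      by (simp_all add: Sigma_mat_def matrix_vector_mult_def vec_eq_iff forall_3 sum_3)
    ultimately show ?thesis
      by (simp add: vector_field_def)
  qed
  ultimately show ?thesis
    by (simp add: equilibrium_def)
qed

end
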